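(* The vector space $\overline{\mathbb{IR}}$ endowed with the norm $\|\mathcal{X}\|=l(\mathcal{X})+|c(\mathcal{X})|$ is a Banach space.
   Context: $\mathbb{IR}$ is the set of non-empty closed bounded intervals $[a,b]$ of $\mathbb{R}$ with $a\le b$ (degenerate intervals allowed), with addition $[a,b]+[c,d]=[a+c,b+d]$; $0$ denotes $[0,0]$. For $\alpha>0$, $\alpha[a,b]=[\alpha a,\alpha b]$. $\overline{\mathbb{IR}}$ is the quotient of $\mathbb{IR}\times\mathbb{IR}$ by $(x,y)\sim(z,t)\iff x+t=y+z$; the class of $(x,y)$ is denoted $\overline{(x,y)}$. It is an abelian group for $\overline{(x,y)}+\overline{(z,t)}=\overline{(x+z,y+t)}$. Every element of $\overline{\mathbb{IR}}$ can be written $\overline{(A,0)}$ or $\overline{(0,A)}$ with $A\in\mathbb{IR}$. It is a real vector space for the external multiplication: for $\alpha>0$, $\alpha\cdot\overline{(A,0)}=\overline{(\alpha A,0)}$ and $\alpha\cdot\overline{(0,A)}=\overline{(0,\alpha A)}$; for $\alpha<0$ and $\beta=-\alpha$, $\alpha\cdot\overline{(A,0)}=\overline{(0,\beta A)}$ and $\alpha\cdot\overline{(0,A)}=\overline{(\beta A,0)}$; and $0\cdot\mathcal{X}=0$. For $A=[a,b]\in\mathbb{IR}$, its length is $l(A)=b-a$ and its center is $c(A)=\frac{a+b}{2}$. For $\mathcal{X}=\overline{(A,0)}$ one sets $l(\mathcal{X})=l(A)$ and $c(\mathcal{X})=c(A)$; for $\mathcal{X}=\overline{(0,A)}$ one sets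 $l(\mathcal{X})=l(A)$ and $c(\mathcal{X})=-c(A)$. *)

theory Defs
  imports "HOL-Analysis.Analysis" "HOL-Library.Interval"
begin

section \<open>Closed bounded real intervals\<close>

text \<open>
  The set of non-empty closed bounded intervals, with its addition and its zero \<open>[0, 0]\<close>, is the
  type \<^typ>\<open>real interval\<close>. The length of an interval is \<^const>\<open>width\<close>.
\<close>

definition center :: "real interval \<Rightarrow> real" where
  "center A = (lower A + upper A) / 2"

text \<open>
  Only used for \<open>\<alpha> > 0\<close>; \<^term>\<open>Ivl a b\<close> is the interval \<open>[a, b]\<close> when \<open>a \<le> b\<close>.
\<close>

definition dilate :: "real \<Rightarrow> real interval \<Rightarrow> real interval" where
  "dilate \<alpha> A = Ivl (\<alpha> * lower A) (\<alpha> * upper A)"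

lemma lower_upper_Ivl:
  fixes a b :: real
  assumes "a \<le> b"
  shows "lower (Ivl a b) = a" and "upper (Ivl a b) = b"
  using assms by (simp_all add: lower.rep_eq upper.rep_eq Ivl.rep_eq)

lemma lower_upper_dilate:
  assumes "\<alpha> > 0"
  shows "lower (dilate \<alpha> A) = \<alpha> * lower A" and "upper (dilate \<alpha> A) = \<alpha> * upper A"
proof -
  have "\<alpha> * lower A \<le> \<alpha> * upper A"
    using assms by (intro mult_left_mono) auto
  then show "lower (dilate \<alpha> A) = \<alpha> * lower A" and "upper (dilate \<alpha> A) = \<alpha> * upper A"
    unfolding dilate_def by (fact lower_upper_Ivl)+
qed


section \<open>The quotient group\<close>

definition interval_rel :: "real interval \<times> real interval \<Rightarrow> real interval \<times> real interval \<Rightarrow> bool"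
  where "interval_rel = (\<lambda>(x, y) (z, t). x + t = y + z)"

lemma interval_rel_iff:
  "interval_rel p q \<longleftrightarrow>
     lower (fst p) - lower (snd p) = lower (fst q) - lower (snd q) \<and>
     upper (fst p) - upper (snd p) = upper (fst q) - upper (snd q)"
  by (auto simp: interval_rel_def interval_eq_iff algebra_simps split: prod.splits)

quotient_type gen_interval = "real interval \<times> real interval" / interval_rel
  morphisms rep_gen_interval abs_gen_interval
  by (rule equivpI) (auto simp: reflp_def symp_def transp_def interval_rel_iff)

lift_definition cls :: "real interval \<Rightarrow> real interval \<Rightarrow> gen_interval" is Pair .

lemma cls_eq_iff: "cls x y = cls z t \<longleftrightarrow> x + t = y + z"
  by transfer (simp add: interval_rel_def)

instantiation gen_interval :: ab_group_add
begin

lift_definition zero_gen_interval :: gen_interval is "(0, 0)" .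

lift_definition plus_gen_interval :: "gen_interval \<Rightarrow> gen_interval \<Rightarrow> gen_interval"
  is "\<lambda>(x, y) (z, t). (x + z, y + t)"
  by (auto simp: interval_rel_iff algebra_simps split: prod.splits)

lift_definition uminus_gen_interval :: "gen_interval \<Rightarrow> gen_interval" is "\<lambda>(x, y). (y, x)"
  by (auto simp: interval_rel_iff algebra_simps split: prod.splits)

definition minus_gen_interval :: "gen_interval \<Rightarrow> gen_interval \<Rightarrow> gen_interval"
  where "X - Y = X + (- Y)" for X Y :: gen_interval

instance
proof
  fix X Y Z :: gen_interval
  show "X + Y + Z = X + (Y + Z)" by transfer (auto simp: interval_rel_iff)
  show "X + Y = Y + X" by transfer (auto simp: interval_rel_iff)
  show "0 + X = X" by transfer (auto simp: interval_rel_iff)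
  show "- X + X = 0" by transfer (auto simp: interval_rel_iff)
  show "X - Y = X + (- Y)" by (fact minus_gen_interval_def)
qed

end

lemma zero_eq_cls: "0 = cls 0 0"
  by transfer (simp add: interval_rel_iff)

lemma cls_plus_cls: "cls x y + cls z t = cls (x + z) (y + t)"
  by transfer (simp add: interval_rel_iff)


subsection \<open>Endpoint differences\<close>

lift_definition lo :: "gen_interval \<Rightarrow> real" is "\<lambda>(x, y). lower x - lower y"
  by (auto simp: interval_rel_iff)

lift_definition up :: "gen_interval \<Rightarrow> real" is "\<lambda>(x, y). upper x - upper y"
  by (auto simp: interval_rel_iff)

lemma gen_interval_eq_iff: "X = Y \<longleftrightarrow> lo X = lo Y \<and> up X = up Y"
  by transfer (auto simp: interval_rel_iff)

lemma lo_up_cls [simp]: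
  "lo (cls x y) = lower x - lower y" "up (cls x y) = upper x - upper y"
  by (transfer; simp)+

lemma lo_up_zero [simp]: "lo 0 = 0" "up 0 = 0"
  by (transfer; simp)+

lemma lo_up_plus [simp]: "lo (X + Y) = lo X + lo Y" "up (X + Y) = up X + up Y"
  by (transfer; auto)+

lemma gen_interval_cases:
  obtains (pos) A where "X = cls A 0" | (neg) A where "X = cls 0 A"
proof (cases "lo X \<le> up X")
  case True
  then have "X = cls (Ivl (lo X) (up X)) 0"
    by (simp add: gen_interval_eq_iff lower_upper_Ivl)
  then show ?thesis by (rule pos)
next
  case False
  then have "X = cls 0 (Ivl (- lo X) (- up X))"
    by (simp add: gen_interval_eq_iff lower_upper_Ivl)
  then show ?thesis by (rule neg)
qed


section \<open>The real vector space\<close>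

instantiation gen_interval :: real_vector
begin

text \<open>
  The defining clauses of the external multiplication; they do determine \<open>\<alpha> \<cdot> X\<close> uniquely,
  which is shown in \<open>scaleR_cls\<close> below.
\<close>

definition scaleR_gen_interval :: "real \<Rightarrow> gen_interval \<Rightarrow> gen_interval" where
  "scaleR_gen_interval \<alpha> X =
     (if \<alpha> = 0 then 0
      else if \<alpha> > 0 then
        (THE Y. \<exists>A. X = cls A 0 \<and> Y = cls (dilate \<alpha> A) 0 \<or> X = cls 0 A \<and> Y = cls 0 (dilate \<alpha> A))
      else
        (THE Y. \<exists>A. X = cls A 0 \<and> Y = cls 0 (dilate (- \<alpha>) A) \<or>
                    X = cls 0 A \<and> Y = cls (dilate (- \<alpha>) A) 0))"

lemma lo_up_scaleR [simp]:
  fixes X :: gen_interval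
  shows "lo (\<alpha> *\<^sub>R X) = \<alpha> * lo X" and "up (\<alpha> *\<^sub>R X) = \<alpha> * up X"
proof -
  let ?P = "\<lambda>Y. lo Y = \<alpha> * lo X \<and> up Y = \<alpha> * up X"
  have unique: "Y = Z" if "?P Y" "?P Z" for Y Z
    using that by (simp add: gen_interval_eq_iff)
  have the: "?P (THE Y. Q Y)" if "\<exists>Y. Q Y" and "\<And>Y. Q Y \<Longrightarrow> ?P Y" for Q
  proof -
    from that(1) obtain Y where "Q Y" ..
    then have "Q (THE Y. Q Y)"
      by (rule theI) (intro unique that(2) \<open>Q Y\<close>)
    then show ?thesis by (rule that(2))
  qed
  have "?P (\<alpha> *\<^sub>R X)"
  proof (cases \<alpha> "0 :: real" rule: linorder_cases)
    case less
    then have neg: "\<not> \<alpha> > 0" "\<alpha> \<noteq> 0" "- \<alpha> > 0" by auto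
    show ?thesis
      unfolding scaleR_gen_interval_def if_not_P[OF neg(1)] if_not_P[OF neg(2)]
    proof (rule the)
      show "\<exists>Y A. X = cls A 0 \<and> Y = cls 0 (dilate (- \<alpha>) A) \<or>
                  X = cls 0 A \<and> Y = cls (dilate (- \<alpha>) A) 0"
        by (cases X rule: gen_interval_cases) blast+
    qed (auto simp: lower_upper_dilate[OF neg(3)])
  next
    case equal
    then show ?thesis by (simp add: scaleR_gen_interval_def)
  next
    case greater
    then have pos: "\<alpha> \<noteq> 0" by simp
    show ?thesis
      unfolding scaleR_gen_interval_def if_not_P[OF pos] if_P[OF greater]
    proof (rule the)
      show "\<exists>Y A. X = cls A 0 \<and> Y = cls (dilate \<alpha> A) 0 \<or> X = cls 0 A \<and> Y = cls 0 (dilate \<alpha> A)"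
        by (cases X rule: gen_interval_cases) blast+
    qed (auto simp: lower_upper_dilate[OF greater])
  qed
  then show "lo (\<alpha> *\<^sub>R X) = \<alpha> * lo X" and "up (\<alpha> *\<^sub>R X) = \<alpha> * up X" by auto
qed

instance
  by standard (simp_all add: gen_interval_eq_iff algebra_simps)

end

lemma scaleR_cls:
  "\<alpha> > 0 \<Longrightarrow> \<alpha> *\<^sub>R cls A 0 = cls (dilate \<alpha> A) 0"
  "\<alpha> > 0 \<Longrightarrow> \<alpha> *\<^sub>R cls 0 A = cls 0 (dilate \<alpha> A)"
  "\<alpha> < 0 \<Longrightarrow> \<alpha> *\<^sub>R cls A 0 = cls 0 (dilate (- \<alpha>) A)"
  "\<alpha> < 0 \<Longrightarrow> \<alpha> *\<^sub>R cls 0 A = cls (dilate (- \<alpha>) A) 0"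
  by (simp_all add: gen_interval_eq_iff lower_upper_dilate)


section \<open>Length, center and norm\<close>

text \<open>The descriptions are proper by \<open>gen_length_cls\<close> and \<open>gen_center_cls\<close>.\<close>

definition gen_length :: "gen_interval \<Rightarrow> real" where
  "gen_length X = (THE r. \<exists>A. (X = cls A 0 \<or> X = cls 0 A) \<and> r = width A)"

definition gen_center :: "gen_interval \<Rightarrow> real" where
  "gen_center X = (THE r. \<exists>A. X = cls A 0 \<and> r = center A \<or> X = cls 0 A \<and> r = - center A)"

lemma gen_length_cls:
  "gen_length (cls A 0) = width A" "gen_length (cls 0 A) = width A"
proof -
  have width: "width B = \<bar>up X - lo X\<bar>" if "X = cls B 0 \<or> X = cls 0 B" for X B
    using that by (elim disjE) (simp_all add: width_def abs_of_nonneg abs_of_nonpos)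
  have "gen_length X = \<bar>up X - lo X\<bar>" if "X = cls B 0 \<or> X = cls 0 B" for X B
    unfolding gen_length_def
  proof (rule the_equality)
    show "\<exists>A. (X = cls A 0 \<or> X = cls 0 A) \<and> \<bar>up X - lo X\<bar> = width A"
      using that width[OF that] by (intro exI[of _ B]) simp
    show "r = \<bar>up X - lo X\<bar>" if "\<exists>A. (X = cls A 0 \<or> X = cls 0 A) \<and> r = width A" for r
      using that width by metis
  qed
  with width show "gen_length (cls A 0) = width A" "gen_length (cls 0 A) = width A"
    by metis+
qed

lemma gen_center_cls:
  "gen_center (cls A 0) = center A" "gen_center (cls 0 A) = - center A"
proof -
  have center: "r = (lo X + up X) / 2"
    if "X = cls B 0 \<and> r = center B \<or> X = cls 0 B \<and> r = - center B" for X B r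
    using that by (elim disjE conjE) (simp_all add: center_def field_simps)
  have "gen_center X = r"
    if r: "X = cls B 0 \<and> r = center B \<or> X = cls 0 B \<and> r = - center B" for X B r
    unfolding gen_center_def
  proof (rule the_equality)
    show "\<exists>A. X = cls A 0 \<and> r = center A \<or> X = cls 0 A \<and> r = - center A"
      using r by (rule exI)
    show "s = r" if "\<exists>A. X = cls A 0 \<and> s = center A \<or> X = cls 0 A \<and> s = - center A" for s
    proof -
      from that obtain A where "X = cls A 0 \<and> s = center A \<or> X = cls 0 A \<and> s = - center A" ..
      from center[OF this] center[OF r] show ?thesis by simp
    qed
  qed
  from this[of _ A] show "gen_center (cls A 0) = center A" "gen_center (cls 0 A) = - center A"
    by simp_all
qed

definition gen_norm :: "gen_interval \<Rightarrow> real" where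
  "gen_norm X = gen_length X + \<bar>gen_center X\<bar>"

text \<open>
  Besides the norm, the instance below only fixes the metric, the uniformity and the topology which
  a norm induces by definition; no property of the norm is involved.
\<close>

instantiation gen_interval :: "{dist_norm, sgn_div_norm, uniformity_dist, open_uniformity}"
begin

definition norm_gen_interval :: "gen_interval \<Rightarrow> real"
  where "norm_gen_interval = gen_norm"

definition dist_gen_interval :: "gen_interval \<Rightarrow> gen_interval \<Rightarrow> real"
  where "dist X Y = norm (X - Y)" for X Y :: gen_interval

definition sgn_gen_interval :: "gen_interval \<Rightarrow> gen_interval"
  where "sgn X = X /\<^sub>R norm X" for X :: gen_interval

definition uniformity_gen_interval :: "(gen_interval \<times> gen_interval) filter"
  where "uniformity = (INF e\<in>{0 <..}. principal {(X, Y :: gen_interval). dist X Y < e})"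

definition open_gen_interval :: "gen_interval set \<Rightarrow> bool"
  where "open U \<longleftrightarrow> (\<forall>X\<in>U. eventually (\<lambda>(X', Y). X' = X \<longrightarrow> Y \<in> U) uniformity)"
  for U :: "gen_interval set"

instance
  by standard
    (simp_all only: dist_gen_interval_def sgn_gen_interval_def uniformity_gen_interval_def
      open_gen_interval_def)

end

end

theory Submission
  imports Defs
begin

text \<open>
  The two endpoint differences \<^const>\<open>lo\<close> and \<^const>\<open>up\<close> identify the space with the plane
  \<open>\<real> \<times> \<real>\<close>: they are linear, jointly injective (\<open>gen_interval_eq_iff\<close>) and jointly surjective
  (\<open>lo_up_surj\<close>). Length and center become \<open>\<bar>up - lo\<bar>\<close> and \<open>(lo + up) / 2\<close>. So the norm
  is a sum of absolute values of two linear forms with no common zero but the origin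
  (\<open>gen_norm_lo_up\<close>), and the norm axioms are inherited from those of the absolute value.

  Completeness comes from that of the reals, one endpoint at a time. The endpoints are dominated by
  the norm (\<open>abs_lo_up_le_norm\<close>), so they send Cauchy sequences to Cauchy sequences of reals; by
  surjectivity the limits of the endpoints are the endpoints of some generalized interval; and as
  the norm is a continuous function of the endpoints, the sequence converges to it
  (\<open>tendsto_if_lo_up_tendsto\<close>).
\<close>

lemma lo_up_minus [simp]: "lo (X - Y) = lo X - lo Y" "up (X - Y) = up X - up Y"
  using lo_up_plus[of "X - Y" Y] by simp_all

text \<open>
  The group completion makes room for \<open>a > b\<close>: subtracting an interval reaches the pairs of
  endpoints in the wrong order.
\<close>

lemma lo_up_surj: obtains X where "lo X = a" "up X = b"
proof (cases "a \<le> b")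
  case True
  then show ?thesis
    by (intro that[of "cls (Ivl a b) 0"]) (simp_all add: lower_upper_Ivl)
next
  case False
  then show ?thesis
    by (intro that[of "cls 0 (Ivl (- a) (- b))"]) (simp_all add: lower_upper_Ivl)
qed

lemma gen_length_lo_up: "gen_length X = \<bar>up X - lo X\<bar>"
  by (cases X rule: gen_interval_cases) (simp_all add: gen_length_cls width_def)

lemma gen_center_lo_up: "gen_center X = (lo X + up X) / 2"
  by (cases X rule: gen_interval_cases) (simp_all add: gen_center_cls center_def field_simps)

lemma gen_norm_lo_up: "gen_norm X = \<bar>up X - lo X\<bar> + \<bar>(lo X + up X) / 2\<bar>"
  by (simp add: gen_norm_def gen_length_lo_up gen_center_lo_up)

lemma gen_norm_eq_0_iff: "gen_norm X = 0 \<longleftrightarrow> X = 0"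
  by (auto simp: gen_norm_lo_up gen_interval_eq_iff add_nonneg_eq_0_iff)

lemma gen_norm_triangle: "gen_norm (X + Y) \<le> gen_norm X + gen_norm Y"
proof -
  have length: "up (X + Y) - lo (X + Y) = (up X - lo X) + (up Y - lo Y)"
    and center: "(lo (X + Y) + up (X + Y)) / 2 = (lo X + up X) / 2 + (lo Y + up Y) / 2"
    by (simp_all add: field_simps)
  show ?thesis
    unfolding gen_norm_lo_up length center
    using abs_triangle_ineq[of "up X - lo X" "up Y - lo Y"]
      abs_triangle_ineq[of "(lo X + up X) / 2" "(lo Y + up Y) / 2"]
    by linarith
qed

lemma gen_norm_scaleR: "gen_norm (\<alpha> *\<^sub>R X) = \<bar>\<alpha>\<bar> * gen_norm X"
proof -
  have "\<alpha> * up X - \<alpha> * lo X = \<alpha> * (up X - lo X)"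
    and "(\<alpha> * lo X + \<alpha> * up X) / 2 = \<alpha> * ((lo X + up X) / 2)"
    by (simp_all add: algebra_simps)
  then show ?thesis
    by (simp only: gen_norm_lo_up lo_up_scaleR abs_mult distrib_left)
qed

instance gen_interval :: real_normed_vector
  by standard
    (simp_all only: norm_gen_interval_def gen_norm_eq_0_iff gen_norm_triangle gen_norm_scaleR)

lemma norm_lo_up: "norm X = \<bar>up X - lo X\<bar> + \<bar>(lo X + up X) / 2\<bar>" for X :: gen_interval
  by (simp add: norm_gen_interval_def gen_norm_lo_up)

text \<open>
  An endpoint differs from the center by half the length, so it is at most the norm in absolute
  value.
\<close>

lemma abs_lo_up_le_norm: "\<bar>lo X\<bar> \<le> norm X" "\<bar>up X\<bar> \<le> norm X"
  unfolding norm_lo_up by (auto simp: abs_if field_simps)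

lemma bounded_linear_lo: "bounded_linear lo"
  by (rule bounded_linear_intro[where K = 1]) (simp_all add: abs_lo_up_le_norm)

lemma bounded_linear_up: "bounded_linear up"
  by (rule bounded_linear_intro[where K = 1]) (simp_all add: abs_lo_up_le_norm)

lemma tendsto_if_lo_up_tendsto:
  fixes L :: gen_interval
  assumes "((\<lambda>x. lo (f x)) \<longlongrightarrow> lo L) F" and "((\<lambda>x. up (f x)) \<longlongrightarrow> up L) F"
  shows "(f \<longlongrightarrow> L) F"
proof -
  have "((\<lambda>x. norm (f x - L)) \<longlongrightarrow>
      \<bar>(up L - up L) - (lo L - lo L)\<bar> + \<bar>((lo L - lo L) + (up L - up L)) / 2\<bar>) F"
    unfolding norm_lo_up lo_up_minus by (intro tendsto_intros assms) simp
  then have "((\<lambda>x. f x - L) \<longlongrightarrow> 0) F"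
    by (intro tendsto_norm_zero_cancel[where f = "\<lambda>x. f x - L"]) simp
  then show ?thesis
    by (rule LIM_zero_cancel)
qed

theorem theorem3:
  shows "OFCLASS(gen_interval, banach_class)"
proof
  fix X :: "nat \<Rightarrow> gen_interval"
  assume "Cauchy X"
  then have "Cauchy (\<lambda>n. lo (X n))" "Cauchy (\<lambda>n. up (X n))"
    by (rule bounded_linear.Cauchy[OF bounded_linear_lo],
        rule bounded_linear.Cauchy[OF bounded_linear_up])
  then obtain a b where "(\<lambda>n. lo (X n)) \<longlonglongrightarrow> a" "(\<lambda>n. up (X n)) \<longlonglongrightarrow> b"
    by (auto simp: Cauchy_convergent_iff convergent_def)
  moreover obtain L where "lo L = a" "up L = b"
    by (rule lo_up_surj)
  ultimately have "X \<longlonglongrightarrow> L"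
    by (simp add: tendsto_if_lo_up_tendsto)
  then show "convergent X"
    by (rule convergentI)
qed

end
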